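(* Let $H$ be an atomic monoid and $u\in\mathcal A(H)$. (1) $\mathsf t(H,uH^\times)=\sup\{\mathsf d(x,\mathsf Z(a)\cap uH^\times\mathsf Z(H)): a\in uH,\ x\in\mathsf Z(a),\ \mathcal A_a(M_H)\ne\emptyset\}$. (2) $\mathsf t(H)=\sup\{\mathsf d(x,\mathsf Z(a)\cap uH^\times\mathsf Z(H)): a\in uH,\ x\in\mathsf Z(a),\ \mathcal A_a(M_H)\ne\emptyset,\ u\in\mathcal A(H)\}$.
   Context: A monoid is a commutative, cancellative semigroup with identity; $H_{\mathrm{red}}=H/H^\times$. $\mathsf Z(H)$ is the free abelian monoid on $\mathcal A(H_{\mathrm{red}})$, $\pi_H:\mathsf Z(H)\to H_{\mathrm{red}}$ the homomorphism restricting to the identity on atoms, $\mathsf Z(a)=\pi_H^{-1}(aH^\times)$. For $z,z'\in\mathsf Z(H)$ with $g=\gcd(z,z')$, $\mathsf d(z,z')=\max\{|g^{-1}z|,|g^{-1}z'|\}$, where $|\cdot|$ is length; for $\emptyset\ne Y\subset\mathsf Z(H)$, $\mathsf d(x,Y)=\min\{\mathsf d(x,y):y\in Y\}$. For $a\in H$ and $x\in\mathsf Z(H)$, $\mathsf t(a,x)$ is the smallest $N\in\mathbb N_0\cup\{\infty\}$ such that: if $\mathsf Z(a)\cap x\mathsf Z(H)\ne\emptyset$ and $z\in\mathsf Z(a)$, then there is $z'\in\mathsf Z(a)\cap x\mathsf Z(H)$ with $\mathsf d(z,z')\le N$. For $H'\subset H$, $X\subset\mathsf Z(H)$, $\mathsf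 t(H',X)=\sup\{\mathsf t(a,x):a\in H',x\in X\}$, and $\mathsf t(H)=\mathsf t(H,\mathcal A(H_{\mathrm{red}}))$ is the tame degree; $\mathsf t(H,uH^\times)$ means $\mathsf t(H,\{uH^\times\})$. $M_H=\{(x,y)\in\mathsf Z(H)^2:\pi_H(x)=\pi_H(y)\}$, $\mathcal A(M_H)$ its atoms, $\mathcal A_a(M_H)=\{(x,y)\in\mathcal A(M_H):\pi_H(x)=aH^\times\}$. The supremum of the empty set is $0$. *)

theory Defs
  imports "HOL-Algebra.Divisibility" "HOL-Algebra.FiniteProduct" "HOL-Library.Multiset"
    "HOL-Library.Extended_Nat"
begin

section \<open>Atomic monoids and their reduced monoids\<close>

text \<open>Monoids are commutative and cancellative throughout, i.e. instances of the locale
  \<^locale>\<open>comm_monoid_cancel\<close>. Only existence of factorizations is required below.\<close>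

locale atomic_monoid = comm_monoid_cancel +
  assumes factors_exist:
    "\<lbrakk>a \<in> carrier G; a \<notin> Units G\<rbrakk> \<Longrightarrow> \<exists>fs. set fs \<subseteq> carrier G \<and> factors G fs a"

definition atoms :: "('a, 'b) monoid_scheme \<Rightarrow> 'a set" where
  "atoms H = {u \<in> carrier H. irreducible H u}"

lemma (in comm_monoid_cancel) atoms_iff:
  "u \<in> atoms G \<longleftrightarrow> u \<in> carrier G \<and> u \<notin> Units G \<and>
     (\<forall>a\<in>carrier G. \<forall>b\<in>carrier G. u = a \<otimes> b \<longrightarrow> a \<in> Units G \<or> b \<in> Units G)"
proof
  assume "u \<in> atoms G"
  then show "u \<in> carrier G \<and> u \<notin> Units G \<and>
     (\<forall>a\<in>carrier G. \<forall>b\<in>carrier G. u = a \<otimes> b \<longrightarrow> a \<in> Units G \<or> b \<in> Units G)"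
    unfolding atoms_def by (metis (no_types, lifting) irreducible_def irreducible_prodE mem_Collect_eq)
next
  assume u: "u \<in> carrier G \<and> u \<notin> Units G \<and>
     (\<forall>a\<in>carrier G. \<forall>b\<in>carrier G. u = a \<otimes> b \<longrightarrow> a \<in> Units G \<or> b \<in> Units G)"
  have "b \<in> Units G" if b: "b \<in> carrier G" "properfactor G b u" for b
  proof -
    obtain c where c: "c \<in> carrier G" "u = b \<otimes> c"
      using b by (auto simp: properfactor_def factor_def)
    have "c \<notin> Units G"
    proof
      assume cu: "c \<in> Units G"
      then have "b = u \<otimes> inv c"
        using b c by (simp add: m_assoc)
      then have "u divides b" using cu by auto
      then show False using b by (simp add: properfactor_def)
    qed
    then show ?thesis using u b c by blast
  qed
  then show "u \<in> atoms G" using u by (simp add: atoms_def irreducible_def)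
qed

text \<open>The class of \<open>a\<close> modulo units. It is a right coset because \<^const>\<open>FactGroup\<close> is
  built from right cosets; by commutativity the side does not matter.\<close>

definition unit_class :: "('a, 'b) monoid_scheme \<Rightarrow> 'a \<Rightarrow> 'a set" where
  "unit_class H a = Units H #>\<^bsub>H\<^esub> a"

text \<open>The operation \<open>Mod\<close> is named after groups, but its definition makes sense here:
  the carrier consists of the classes \<open>unit_class H a\<close>, multiplied as subsets of \<open>H\<close>.\<close>

definition reduced :: "('a, 'b) monoid_scheme \<Rightarrow> 'a set monoid" where
  "reduced H = H Mod (Units H)"

lemma (in comm_monoid) unit_class_mult:
  assumes a: "a \<in> carrier G" and b: "b \<in> carrier G"
  shows "unit_class G a \<otimes>\<^bsub>reduced G\<^esub> unit_class G b = unit_class G (a \<otimes> b)"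
proof -
  have "unit_class G a \<otimes>\<^bsub>reduced G\<^esub> unit_class G b =
      {h \<otimes> a \<otimes> (k \<otimes> b) | h k. h \<in> Units G \<and> k \<in> Units G}"
    by (auto simp: unit_class_def reduced_def FactGroup_def set_mult_def r_coset_def)
  also have "\<dots> = {l \<otimes> (a \<otimes> b) | l. l \<in> Units G}"
  proof (intro equalityI subsetI)
    fix x assume "x \<in> {h \<otimes> a \<otimes> (k \<otimes> b) | h k. h \<in> Units G \<and> k \<in> Units G}"
    then obtain h k where hk: "h \<in> Units G" "k \<in> Units G" "x = h \<otimes> a \<otimes> (k \<otimes> b)" by blast
    then have "x = (h \<otimes> k) \<otimes> (a \<otimes> b)" using a b by (simp add: Units_closed m_ac)
    then show "x \<in> {l \<otimes> (a \<otimes> b) | l. l \<in> Units G}" using hk by blast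
  next
    fix x assume "x \<in> {l \<otimes> (a \<otimes> b) | l. l \<in> Units G}"
    then obtain l where l: "l \<in> Units G" "x = l \<otimes> (a \<otimes> b)" by blast
    then have "x = l \<otimes> a \<otimes> (\<one> \<otimes> b)" using a b by (simp add: Units_closed m_assoc)
    then show "x \<in> {h \<otimes> a \<otimes> (k \<otimes> b) | h k. h \<in> Units G \<and> k \<in> Units G}"
      using l(1) by blast
  qed
  also have "\<dots> = unit_class G (a \<otimes> b)"
    by (auto simp: unit_class_def r_coset_def)
  finally show ?thesis .
qed

lemma (in comm_monoid) unit_class_one: "unit_class G \<one> = \<one>\<^bsub>reduced G\<^esub>"
  by (auto simp: unit_class_def reduced_def FactGroup_def r_coset_def Units_closed)

lemma carrier_reduced: "carrier (reduced H) = unit_class H ` carrier H"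
  by (auto simp: unit_class_def reduced_def FactGroup_def RCOSETS_def)

lemma (in comm_monoid) comm_monoid_reduced: "comm_monoid (reduced G)"
proof (rule comm_monoidI)
  show "\<one>\<^bsub>reduced G\<^esub> \<in> carrier (reduced G)"
    unfolding unit_class_one[symmetric] carrier_reduced by simp
  show "\<one>\<^bsub>reduced G\<^esub> \<otimes>\<^bsub>reduced G\<^esub> x = x"
    if "x \<in> carrier (reduced G)" for x
    using that unfolding unit_class_one[symmetric] carrier_reduced
    by (auto simp: unit_class_mult)
  show "x \<otimes>\<^bsub>reduced G\<^esub> y = y \<otimes>\<^bsub>reduced G\<^esub> x"
    if "x \<in> carrier (reduced G)" "y \<in> carrier (reduced G)" for x y
    using that unfolding carrier_reduced by (auto simp only: unit_class_mult m_comm)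
qed (auto simp: carrier_reduced unit_class_mult m_assoc)


section \<open>Factorizations\<close>

text \<open>The free abelian monoid on \<open>atoms (reduced H)\<close>, written additively as multisets.
  An atom \<open>p\<close> of the reduced monoid is identified with \<open>{#p#}\<close>, length is \<^const>\<open>size\<close>,
  and the greatest common divisor is multiset intersection.\<close>

definition fact_monoid :: "('a, 'b) monoid_scheme \<Rightarrow> 'a set multiset monoid" where
  "fact_monoid H =
     \<lparr>carrier = {z. set_mset z \<subseteq> atoms (reduced H)}, mult = (+), one = {#}\<rparr>"

definition fact_hom :: "('a, 'b) monoid_scheme \<Rightarrow> 'a set multiset \<Rightarrow> 'a set" where
  "fact_hom H z =
     (\<Otimes>\<^bsub>reduced H\<^esub>p\<in>set_mset z. p [^]\<^bsub>reduced H\<^esub> count z p)"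

definition facts :: "('a, 'b) monoid_scheme \<Rightarrow> 'a \<Rightarrow> 'a set multiset set" where
  "facts H a = {z \<in> carrier (fact_monoid H). fact_hom H z = unit_class H a}"

lemma (in comm_monoid) fact_hom_single:
  "p \<in> atoms (reduced G) \<Longrightarrow> fact_hom G {#p#} = p"
proof -
  interpret R: comm_monoid "reduced G" by (rule comm_monoid_reduced)
  assume "p \<in> atoms (reduced G)"
  then have "p \<in> carrier (reduced G)" by (simp add: atoms_def)
  then show ?thesis by (simp add: fact_hom_def)
qed

lemma (in comm_monoid) fact_hom_hom: "fact_hom G \<in> hom (fact_monoid G) (reduced G)"
proof -
  interpret R: comm_monoid "reduced G" by (rule comm_monoid_reduced)
  have ext: "fact_hom G z = (\<Otimes>\<^bsub>reduced G\<^esub>p\<in>A. p [^]\<^bsub>reduced G\<^esub> count z p)"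
    if "finite A" "set_mset z \<subseteq> A" "A \<subseteq> carrier (reduced G)" for z A
    unfolding fact_hom_def
    by (rule R.finprod_mono_neutral_cong_left) (use that in \<open>auto simp: not_in_iff\<close>)
  show ?thesis
  proof (rule homI)
    fix x assume "x \<in> carrier (fact_monoid G)"
    then show "fact_hom G x \<in> carrier (reduced G)"
      by (auto simp: fact_hom_def fact_monoid_def atoms_def intro!: R.finprod_closed)
  next
    fix x y assume "x \<in> carrier (fact_monoid G)" "y \<in> carrier (fact_monoid G)"
    then have sub: "set_mset x \<union> set_mset y \<subseteq> carrier (reduced G)"
      by (auto simp: fact_monoid_def atoms_def)
    let ?A = "set_mset x \<union> set_mset y"
    have "fact_hom G (x + y) = (\<Otimes>\<^bsub>reduced G\<^esub>p\<in>?A. p [^]\<^bsub>reduced G\<^esub> count (x + y) p)"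
      using sub by (intro ext) auto
    also have "\<dots> = (\<Otimes>\<^bsub>reduced G\<^esub>p\<in>?A.
        p [^]\<^bsub>reduced G\<^esub> count x p \<otimes>\<^bsub>reduced G\<^esub> p [^]\<^bsub>reduced G\<^esub> count y p)"
      using sub by (intro R.finprod_cong') (auto simp: R.nat_pow_mult subset_iff)
    also have "\<dots> = fact_hom G x \<otimes>\<^bsub>reduced G\<^esub> fact_hom G y"
      using sub by (subst R.finprod_multf) (auto simp: ext[of ?A] subset_iff)
    finally show "fact_hom G (x \<otimes>\<^bsub>fact_monoid G\<^esub> y) =
        fact_hom G x \<otimes>\<^bsub>reduced G\<^esub> fact_hom G y"
      by (simp add: fact_monoid_def)
  qed
qed

definition fact_dist :: "'c multiset \<Rightarrow> 'c multiset \<Rightarrow> nat" where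
  "fact_dist z z' = (let g = z \<inter># z' in max (size (z - g)) (size (z' - g)))"

text \<open>Intended for nonempty \<open>Y\<close> only.\<close>

definition fact_dist_set :: "'c multiset \<Rightarrow> 'c multiset set \<Rightarrow> nat" where
  "fact_dist_set x Y = (LEAST n. n \<in> fact_dist x ` Y)"

text \<open>The principal ideal \<open>x Z(H)\<close> of the factorization monoid.\<close>

definition fact_ideal :: "('a, 'b) monoid_scheme \<Rightarrow> 'a set multiset \<Rightarrow> 'a set multiset set" where
  "fact_ideal H x = x <#\<^bsub>fact_monoid H\<^esub> carrier (fact_monoid H)"


section \<open>Tame degrees\<close>

definition tame :: "('a, 'b) monoid_scheme \<Rightarrow> 'a \<Rightarrow> 'a set multiset \<Rightarrow> enat" where
  "tame H a x = (LEAST N. \<forall>z. facts H a \<inter> fact_ideal H x \<noteq> {} \<and> z \<in> facts H a \<longrightarrow>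
     (\<exists>z' \<in> facts H a \<inter> fact_ideal H x. enat (fact_dist z z') \<le> N))"

text \<open>Suprema are taken in \<^typ>\<open>enat\<close>, where the supremum of the empty set is \<open>0\<close>.\<close>

definition tame_sup :: "('a, 'b) monoid_scheme \<Rightarrow> 'a set \<Rightarrow> 'a set multiset set \<Rightarrow> enat" where
  "tame_sup H H' X = Sup {tame H a x | a x. a \<in> H' \<and> x \<in> X}"

definition tame_degree :: "('a, 'b) monoid_scheme \<Rightarrow> enat" where
  "tame_degree H = tame_sup H (carrier H) ((\<lambda>p. {#p#}) ` atoms (reduced H))"


section \<open>The monoid of relations\<close>

definition rel_monoid ::
  "('a, 'b) monoid_scheme \<Rightarrow> ('a set multiset \<times> 'a set multiset) monoid" where
  "rel_monoid H = (fact_monoid H \<times>\<times> fact_monoid H)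
     \<lparr>carrier := {(x, y). x \<in> carrier (fact_monoid H) \<and> y \<in> carrier (fact_monoid H) \<and>
                          fact_hom H x = fact_hom H y}\<rparr>"

definition rel_atoms_at ::
  "('a, 'b) monoid_scheme \<Rightarrow> 'a \<Rightarrow> ('a set multiset \<times> 'a set multiset) set" where
  "rel_atoms_at H a = {(x, y) \<in> atoms (rel_monoid H). fact_hom H x = unit_class H a}"

end

theory Submission
  imports Defs
begin

text \<open>A pair \<open>(z, z')\<close> of factorizations of \<open>a\<close> with \<open>u\<close> occurring in \<open>z'\<close> dominates an atom
  \<open>(x, y)\<close> of the monoid of relations with \<open>x\<close> dividing \<open>z\<close> and \<open>u\<close> occurring in \<open>y\<close>: any pair of
  this kind of minimal total length is an atom. Adding \<open>z - x\<close> to the factorizations of the class of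
  \<open>x\<close> that contain \<open>u\<close> leaves distances unchanged, so the distance of \<open>z\<close> is at most that of \<open>x\<close>.\<close>

section \<open>Distances\<close>

text \<open>The common summand \<open>w\<close> enters the intersection in full, so it cancels from
  both complements.\<close>

lemma fact_dist_add_right: "fact_dist (x + w) (y + w) = fact_dist x y"
proof -
  have "(x + w) \<inter># (y + w) = x \<inter># y + w"
    by (rule multiset_eqI) simp
  then show ?thesis by (simp add: fact_dist_def Let_def)
qed

lemma fact_dist_set_le: "y \<in> Y \<Longrightarrow> fact_dist_set x Y \<le> fact_dist x y"
  unfolding fact_dist_set_def by (rule Least_le) simp

lemma fact_dist_set_attained:
  assumes "Y \<noteq> {}"
  obtains y where "y \<in> Y" "fact_dist x y = fact_dist_set x Y"
proof -
  from assms obtain y where "fact_dist x y \<in> fact_dist x ` Y" by blast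
  then have "(LEAST n. n \<in> fact_dist x ` Y) \<in> fact_dist x ` Y" by (rule LeastI)
  then show thesis by (auto simp: fact_dist_set_def intro: that)
qed

text \<open>A minimum over a nonempty set is attained, so \<open>N\<close> works for a given
  \<open>z\<close> exactly when it bounds the \<open>fact_dist_set\<close> of \<open>z\<close>; the
  least common bound is the supremum. The empty case is separate: there the condition is vacuous,
  the least \<open>N\<close> is 0, and \<open>fact_dist_set\<close> carries no meaning.\<close>

lemma tame_eq_Sup:
  "tame H a x = (if facts H a \<inter> fact_ideal H x = {} then 0
     else SUP z\<in>facts H a. enat (fact_dist_set z (facts H a \<inter> fact_ideal H x)))"
proof (cases "facts H a \<inter> fact_ideal H x = {}")
  case True
  then show ?thesis by (auto simp: tame_def intro: Least_equality)
next
  case False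
  let ?Y = "facts H a \<inter> fact_ideal H x"
  have *: "(\<exists>z'\<in>?Y. enat (fact_dist z z') \<le> N) \<longleftrightarrow> enat (fact_dist_set z ?Y) \<le> N" for z N
  proof
    assume "\<exists>z'\<in>?Y. enat (fact_dist z z') \<le> N"
    then show "enat (fact_dist_set z ?Y) \<le> N"
      using fact_dist_set_le[of _ ?Y z] by (meson enat_ord_simps(1) order_trans)
  next
    assume "enat (fact_dist_set z ?Y) \<le> N"
    then show "\<exists>z'\<in>?Y. enat (fact_dist z z') \<le> N"
      using fact_dist_set_attained[OF False] by metis
  qed
  have "tame H a x = (LEAST N. (SUP z\<in>facts H a. enat (fact_dist_set z ?Y)) \<le> N)"
    unfolding tame_def * using False by (simp add: SUP_le_iff Ball_def)
  also have "\<dots> = (SUP z\<in>facts H a. enat (fact_dist_set z ?Y))"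
    by (rule Least_equality) simp_all
  finally show ?thesis using False by simp
qed


section \<open>The reduced monoid\<close>

context comm_monoid_cancel
begin

lemma unit_class_eq_iff:
  assumes "a \<in> carrier G" "b \<in> carrier G"
  shows "unit_class G a = unit_class G b \<longleftrightarrow> (\<exists>e\<in>Units G. a = e \<otimes> b)"
proof
  assume "unit_class G a = unit_class G b"
  moreover have "\<one> \<otimes> a \<in> unit_class G a"
    unfolding unit_class_def r_coset_def by blast
  ultimately show "\<exists>e\<in>Units G. a = e \<otimes> b"
    using assms by (auto simp: unit_class_def r_coset_def)
next
  assume "\<exists>e\<in>Units G. a = e \<otimes> b"
  then obtain e where e: "e \<in> Units G" "a = e \<otimes> b" by blast
  have "\<exists>l\<in>Units G. k \<otimes> a = l \<otimes> b" if "k \<in> Units G" for k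
  proof
    show "k \<otimes> a = (k \<otimes> e) \<otimes> b" using that e assms by (simp add: m_assoc Units_closed)
  qed (use that e in simp)
  moreover have "\<exists>l\<in>Units G. k \<otimes> b = l \<otimes> a" if "k \<in> Units G" for k
  proof
    \<comment> \<open>\<open>inv e \<otimes> e\<close> is kept uncollapsed so that reassociation
      alone proves the equation; the cancellation follows in the next line.\<close>
    have "(k \<otimes> inv e) \<otimes> a = k \<otimes> ((inv e \<otimes> e) \<otimes> b)"
      unfolding e(2) using that e(1) assms by (simp add: m_assoc Units_closed del: Units_l_inv)
    then show "k \<otimes> b = (k \<otimes> inv e) \<otimes> a" using e(1) assms by simp
  qed (use that e in simp)
  ultimately show "unit_class G a = unit_class G b"
    unfolding unit_class_def r_coset_def by blast
qed

text \<open>An equation of classes is an equation in \<open>G\<close> up to a unit factor, and that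
  factor survives cancelling \<open>c\<close>. This makes \<open>atoms_iff\<close> available in the
  reduced monoid.\<close>

lemma comm_monoid_cancel_reduced: "comm_monoid_cancel (reduced G)"
proof -
  interpret R: comm_monoid "reduced G" by (rule comm_monoid_reduced)
  show ?thesis
  proof (rule comm_monoid_cancelI)
    show "comm_monoid (reduced G)" ..
    fix x y z
    assume eq: "x \<otimes>\<^bsub>reduced G\<^esub> z = y \<otimes>\<^bsub>reduced G\<^esub> z"
      and "x \<in> carrier (reduced G)" "y \<in> carrier (reduced G)" "z \<in> carrier (reduced G)"
    then obtain a b c where abc: "a \<in> carrier G" "b \<in> carrier G" "c \<in> carrier G"
      and xyz: "x = unit_class G a" "y = unit_class G b" "z = unit_class G c"
      by (auto simp: carrier_reduced)
    from eq abc obtain e where e: "e \<in> Units G" "a \<otimes> c = e \<otimes> (b \<otimes> c)"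
      by (auto simp: xyz unit_class_mult unit_class_eq_iff)
    then have "a \<otimes> c = (e \<otimes> b) \<otimes> c" using abc by (simp add: m_assoc Units_closed)
    then have "a = e \<otimes> b" using abc e(1) r_cancel[of a c "e \<otimes> b"] by (simp add: Units_closed)
    then show "x = y" using abc e unfolding xyz by (subst unit_class_eq_iff) auto
  qed
qed

lemma unit_class_eq_one_iff:
  assumes "a \<in> carrier G"
  shows "unit_class G a = \<one>\<^bsub>reduced G\<^esub> \<longleftrightarrow> a \<in> Units G"
  using assms by (auto simp: unit_class_one[symmetric] unit_class_eq_iff Units_closed)

lemma unit_class_Units_iff:
  assumes "a \<in> carrier G"
  shows "unit_class G a \<in> Units (reduced G) \<longleftrightarrow> a \<in> Units G"
proof
  assume "unit_class G a \<in> Units (reduced G)"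
  then obtain b where b: "b \<in> carrier G"
    and "unit_class G b \<otimes>\<^bsub>reduced G\<^esub> unit_class G a = \<one>\<^bsub>reduced G\<^esub>"
    unfolding Units_def carrier_reduced by blast
  then have "b \<otimes> a \<in> Units G"
    using assms by (simp add: unit_class_mult unit_class_eq_one_iff)
  then show "a \<in> Units G" using assms b unit_factor m_comm by metis
next
  interpret R: comm_monoid "reduced G" by (rule comm_monoid_reduced)
  assume "a \<in> Units G"
  then show "unit_class G a \<in> Units (reduced G)"
    using assms by (simp add: unit_class_eq_one_iff[THEN iffD2])
qed

text \<open>Passing to classes turns \<open>u = a \<otimes> b\<close> into
  \<open>u = e \<otimes> (a \<otimes> b)\<close> with a unit \<open>e\<close>. Absorbing
  \<open>e\<close> into \<open>a\<close> does not affect whether \<open>a\<close> is a unit.\<close>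

lemma unit_class_atoms_iff:
  assumes u: "u \<in> carrier G"
  shows "unit_class G u \<in> atoms (reduced G) \<longleftrightarrow> u \<in> atoms G"
proof -
  interpret R: comm_monoid_cancel "reduced G" by (rule comm_monoid_cancel_reduced)
  have "(\<forall>a\<in>carrier G. \<forall>b\<in>carrier G. (\<exists>e\<in>Units G. u = e \<otimes> (a \<otimes> b)) \<longrightarrow>
          a \<in> Units G \<or> b \<in> Units G) \<longleftrightarrow>
        (\<forall>a\<in>carrier G. \<forall>b\<in>carrier G. u = a \<otimes> b \<longrightarrow> a \<in> Units G \<or> b \<in> Units G)"
    (is "?L \<longleftrightarrow> ?R")
  proof
    assume ?L
    then show ?R by (metis Units_one_closed l_one m_closed)
  next
    assume R: ?R
    show ?L
    proof (intro ballI impI)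
      fix a b assume ab: "a \<in> carrier G" "b \<in> carrier G" "\<exists>e\<in>Units G. u = e \<otimes> (a \<otimes> b)"
      then obtain e where e: "e \<in> Units G" "u = (e \<otimes> a) \<otimes> b" by (auto simp: m_assoc Units_closed)
      then have "e \<otimes> a \<in> Units G \<or> b \<in> Units G" using R ab by (simp add: Units_closed)
      then show "a \<in> Units G \<or> b \<in> Units G"
        using e ab by (metis Units_closed m_comm unit_factor)
    qed
  qed
  then show ?thesis
    using u unfolding R.atoms_iff atoms_iff carrier_reduced
    by (simp add: unit_class_Units_iff unit_class_mult unit_class_eq_iff)
qed

lemma atoms_reduced: "atoms (reduced G) = unit_class G ` atoms G"
proof -
  have "atoms (reduced G) \<subseteq> unit_class G ` carrier G"
    by (auto simp: atoms_def carrier_reduced)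
  moreover have "atoms G \<subseteq> carrier G" by (auto simp: atoms_def)
  ultimately show ?thesis using unit_class_atoms_iff by blast
qed


section \<open>Factorizations\<close>

lemma fact_hom_closed:
  "z \<in> carrier (fact_monoid G) \<Longrightarrow> fact_hom G z \<in> carrier (reduced G)"
  using fact_hom_hom by (auto simp: hom_def)

lemma fact_hom_add:
  "\<lbrakk>x \<in> carrier (fact_monoid G); y \<in> carrier (fact_monoid G)\<rbrakk> \<Longrightarrow>
    fact_hom G (x + y) = fact_hom G x \<otimes>\<^bsub>reduced G\<^esub> fact_hom G y"
  using fact_hom_hom by (auto simp: hom_def fact_monoid_def)

lemma fact_hom_empty: "fact_hom G {#} = \<one>\<^bsub>reduced G\<^esub>"
proof -
  interpret R: comm_monoid "reduced G" by (rule comm_monoid_reduced)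
  show ?thesis by (simp add: fact_hom_def)
qed

text \<open>Removing one copy of \<open>p\<close> leaves a multiset of atoms, which is the required
  cofactor. Divisibility thereby becomes mere occurrence of \<open>p\<close>.\<close>

lemma fact_ideal_single:
  "p \<in> atoms (reduced G) \<Longrightarrow>
    fact_ideal G {#p#} = {z \<in> carrier (fact_monoid G). p \<in># z}"
  by (auto simp: fact_ideal_def l_coset_def fact_monoid_def)
    (metis add_mset_remove_trivial in_diffD insert_DiffM subset_iff)

text \<open>Supplies representatives: \<open>facts\<close> and \<open>rel_atoms_at\<close> are
  indexed by elements of \<open>G\<close>, not by classes.\<close>

lemma fact_hom_eq_unit_class:
  assumes "z \<in> carrier (fact_monoid G)"
  obtains a where "a \<in> carrier G" "unit_class G a = fact_hom G z"
  using fact_hom_closed[OF assms] unfolding carrier_reduced by auto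

text \<open>The rest \<open>w\<close> of \<open>z\<close> represents the class of some
  \<open>b\<close>, so \<open>a\<close> equals \<open>u \<otimes> b\<close> up to a unit, and the
  unit can be moved into \<open>b\<close>.\<close>

lemma mem_coset_if_mem_fact:
  assumes u: "u \<in> atoms G" and a: "a \<in> carrier G"
    and z: "z \<in> facts G a" "unit_class G u \<in># z"
  shows "a \<in> u <# carrier G"
proof -
  from z(2) obtain w where w: "z = {#unit_class G u#} + w"
    by (auto dest: multi_member_split)
  with z(1) have wz: "w \<in> carrier (fact_monoid G)"
      "{#unit_class G u#} \<in> carrier (fact_monoid G)"
      "fact_hom G z = unit_class G a"
    by (auto simp: facts_def fact_monoid_def)
  obtain b where b: "b \<in> carrier G" "unit_class G b = fact_hom G w"
    using wz(1) by (rule fact_hom_eq_unit_class)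
  have uc: "u \<in> carrier G" using u by (simp add: atoms_def)
  have "unit_class G a = unit_class G (u \<otimes> b)"
    using wz u uc b fact_hom_add[OF wz(2,1)] fact_hom_single[of "unit_class G u"]
    by (simp add: w atoms_reduced flip: unit_class_mult)
  then obtain e where e: "e \<in> Units G" "a = e \<otimes> (u \<otimes> b)"
    using a b uc by (auto simp: unit_class_eq_iff)
  then have "a = u \<otimes> (e \<otimes> b)" using uc b by (simp add: Units_closed m_lcomm)
  then show ?thesis using e b by (auto simp: l_coset_def)
qed

text \<open>Minimality of \<open>size x + size y\<close> forces the component of a decomposition without \<open>p\<close> in its
  second entry to be trivial.\<close>

lemma exists_rel_atom:
  assumes zz: "z \<in> carrier (fact_monoid G)" "z' \<in> carrier (fact_monoid G)"
    and eq: "fact_hom G z = fact_hom G z'" and p: "p \<in># z'"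
  obtains x y where "x \<subseteq># z" "p \<in># y" "(x, y) \<in> atoms (rel_monoid G)"
proof -
  \<comment> \<open>The second entry need only contain \<open>p\<close>, not divide
    \<open>z'\<close>: it will serve only as a witness that the class of \<open>x\<close> has a
    factorization containing \<open>p\<close>.\<close>
  define P where "P = (\<lambda>(x, y). (x, y) \<in> carrier (rel_monoid G) \<and> x \<subseteq># z \<and> p \<in># y)"
  have "P (z, z')" using assms by (simp add: P_def rel_monoid_def)
  then obtain v where v: "P v"
    and min: "\<And>w. P w \<Longrightarrow> size (fst v) + size (snd v) \<le> size (fst w) + size (snd w)"
    using ex_has_least_nat[of P _ "\<lambda>v. size (fst v) + size (snd v)"] by blast
  obtain x y where xy: "v = (x, y)" by fastforce
  have mult: "(x1, y1) \<otimes>\<^bsub>rel_monoid G\<^esub> (x2, y2) = (x1 + x2, y1 + y2)"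
    for x1 x2 y1 y2 by (simp add: rel_monoid_def fact_monoid_def)
  have one: "\<one>\<^bsub>rel_monoid G\<^esub> = ({#}, {#})"
    by (simp add: rel_monoid_def fact_monoid_def DirProd_def)
  have unit: "({#}, {#}) \<in> Units (rel_monoid G)"
    by (auto simp: Units_def one mult)
      (simp_all add: rel_monoid_def fact_monoid_def)
  \<comment> \<open>A unit has both entries empty, but \<open>p\<close> occurs in the second entry
    of \<open>v\<close>.\<close>
  have "v \<notin> Units (rel_monoid G)"
    using v by (auto simp: Units_def one mult xy P_def)
  moreover have "b \<in> Units (rel_monoid G)"
    if b: "b \<in> carrier (rel_monoid G)" "properfactor (rel_monoid G) b v" for b
  proof -
    obtain c where c: "c \<in> carrier (rel_monoid G)" "v = b \<otimes>\<^bsub>rel_monoid G\<^esub> c"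
      using b by (auto simp: properfactor_def factor_def)
    obtain x1 y1 x2 y2 where bc: "b = (x1, y1)" "c = (x2, y2)" by fastforce
    have s: "x = x1 + x2" "y = y1 + y2" using c xy by (auto simp: bc mult)
    have "p \<in># y" "x \<subseteq># z" using v by (auto simp: P_def xy)
    then have sub: "x1 \<subseteq># z" "x2 \<subseteq># z"
      unfolding s by (auto intro: subset_mset.order_trans[rotated])
    \<comment> \<open>Otherwise \<open>b\<close> itself satisfies \<open>P\<close>; minimality makes
      \<open>c\<close> trivial, so \<open>b = v\<close> is not a proper factor.\<close>
    have "p \<notin># y1"
    proof
      assume "p \<in># y1"
      then have "P (x1, y1)" using b(1) sub by (simp add: P_def bc)
      from min[OF this] have "b = v" by (simp add: xy s bc)
      moreover have "v divides\<^bsub>rel_monoid G\<^esub> v"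
        by (rule dividesI[of "({#}, {#})"]) (use unit in \<open>auto simp: xy mult Units_def\<close>)
      ultimately show False using b by (simp add: properfactor_def)
    qed
    \<comment> \<open>Now \<open>p\<close> must lie in \<open>y2\<close>, and minimality of
      \<open>v\<close> against \<open>c\<close> leaves both entries of \<open>b\<close>
      empty.\<close>
    then have "P (x2, y2)" using \<open>p \<in># y\<close> c(1) sub by (simp add: P_def bc s)
    from min[OF this] show ?thesis using unit by (simp add: xy s bc)
  qed
  ultimately have "(x, y) \<in> atoms (rel_monoid G)"
    using v by (simp add: atoms_def irreducible_def P_def xy)
  then show thesis using that v by (auto simp: P_def xy)
qed

lemma fact_dist_set_le_rel_atom:
  assumes u: "u \<in> atoms G" and a: "a \<in> carrier G" and z: "z \<in> facts G a"
    and ne: "facts G a \<inter> fact_ideal G {#unit_class G u#} \<noteq> {}"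
  obtains a' x where "a' \<in> u <# carrier G" "x \<in> facts G a'" "rel_atoms_at G a' \<noteq> {}"
    "fact_dist_set z (facts G a \<inter> fact_ideal G {#unit_class G u#}) \<le>
     fact_dist_set x (facts G a' \<inter> fact_ideal G {#unit_class G u#})"
proof -
  let ?p = "unit_class G u"
  have p: "?p \<in> atoms (reduced G)" using u by (simp add: atoms_reduced)
  note ideal = fact_ideal_single[OF p]
  obtain z' where z': "z' \<in> facts G a" "?p \<in># z'" using ne by (auto simp: ideal)
  obtain x y where xy: "x \<subseteq># z" "?p \<in># y" "(x, y) \<in> atoms (rel_monoid G)"
    using exists_rel_atom[of z z' ?p] z z' by (auto simp: facts_def)
  then have xyc: "x \<in> carrier (fact_monoid G)" "y \<in> carrier (fact_monoid G)"
      "fact_hom G x = fact_hom G y"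
    by (auto simp: atoms_def rel_monoid_def)
  obtain a' where a': "a' \<in> carrier G" "unit_class G a' = fact_hom G x"
    using xyc(1) by (rule fact_hom_eq_unit_class)
  have facts: "x \<in> facts G a'" "y \<in> facts G a'" using xyc a' by (auto simp: facts_def)
  obtain w where w: "z = x + w" using xy(1) by (auto simp: subset_mset.le_iff_add)
  have wc: "w \<in> carrier (fact_monoid G)" using z by (simp add: w facts_def fact_monoid_def)
  \<comment> \<open>\<open>y\<close> shows that the minimum for \<open>x\<close> is over a nonempty
    set; the minimizer \<open>y0\<close> may differ from \<open>y\<close>.\<close>
  have "facts G a' \<inter> fact_ideal G {#?p#} \<noteq> {}"
    using facts xy(2) xyc by (auto simp: ideal)
  then obtain y0 where y0: "y0 \<in> facts G a' \<inter> fact_ideal G {#?p#}"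
    and d: "fact_dist x y0 = fact_dist_set x (facts G a' \<inter> fact_ideal G {#?p#})"
    by (rule fact_dist_set_attained)
  have y0c: "y0 \<in> carrier (fact_monoid G)" "fact_hom G y0 = fact_hom G x"
    using y0 a' by (auto simp: facts_def)
  \<comment> \<open>Replacing \<open>x\<close> by \<open>y0\<close> inside \<open>z = x + w\<close>
    gives a factorization of \<open>a\<close> that contains \<open>u\<close> and lies as far from
    \<open>z\<close> as \<open>y0\<close> from \<open>x\<close>.\<close>
  have "fact_hom G (y0 + w) = fact_hom G z"
    using y0c xyc wc by (simp add: w fact_hom_add)
  moreover have "y0 + w \<in> carrier (fact_monoid G)"
    using y0c wc by (simp add: fact_monoid_def)
  ultimately have "y0 + w \<in> facts G a \<inter> fact_ideal G {#?p#}"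
    using y0 z by (auto simp: ideal facts_def)
  from fact_dist_set_le[OF this, of z]
  have "fact_dist_set z (facts G a \<inter> fact_ideal G {#?p#}) \<le> fact_dist x y0"
    by (simp add: w fact_dist_add_right)
  moreover have "rel_atoms_at G a' \<noteq> {}" using xy(3) a' by (auto simp: rel_atoms_at_def)
  ultimately show thesis
    using that[of a' x] mem_coset_if_mem_fact[OF u a'(1) facts(2) xy(2)] facts(1)
    by (simp add: d)
qed

end

section \<open>Existence of factorizations and the supremum formulas\<close>

context atomic_monoid
begin

text \<open>Atomicity enters here: the classes of a factor list form a factorization. A unit has the
  empty one.\<close>

lemma facts_nonempty:
  assumes "a \<in> carrier G"
  shows "facts G a \<noteq> {}"
proof (cases "a \<in> Units G")
  case True
  then have "{#} \<in> facts G a"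
    using unit_class_eq_one_iff[OF assms] by (simp add: facts_def fact_hom_empty fact_monoid_def)
  then show ?thesis by blast
next
  case False
  then obtain fs where fs: "set fs \<subseteq> carrier G" "factors G fs a"
    using factors_exist assms by blast
  \<comment> \<open>Stated for the product of an arbitrary list, so that the induction can drop the
    head; for the list obtained above the product is \<open>a\<close>.\<close>
  have "set fs \<subseteq> atoms G \<Longrightarrow> mset (map (unit_class G) fs) \<in> facts G (foldr (\<otimes>) fs \<one>)" for fs
  proof (induction fs)
    case Nil
    show ?case by (simp add: facts_def fact_hom_empty unit_class_one fact_monoid_def)
  next
    case (Cons u fs)
    let ?z = "mset (map (unit_class G) fs)"
    have u: "u \<in> carrier G" "unit_class G u \<in> atoms (reduced G)"
      using Cons.prems by (simp_all add: atoms_reduced) (simp add: atoms_def)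
    have fs: "set fs \<subseteq> carrier G" using Cons.prems by (auto simp: atoms_def)
    have z: "?z \<in> facts G (foldr (\<otimes>) fs \<one>)" using Cons by simp
    have "{#unit_class G u#} \<in> carrier (fact_monoid G)" "?z \<in> carrier (fact_monoid G)"
      using u z by (auto simp: fact_monoid_def facts_def)
    moreover from this have "{#unit_class G u#} + ?z \<in> carrier (fact_monoid G)"
      by (simp add: fact_monoid_def)
    ultimately have "{#unit_class G u#} + ?z \<in> facts G (foldr (\<otimes>) (u # fs) \<one>)"
      using u z fs fact_hom_add[of "{#unit_class G u#}" ?z] fact_hom_single[OF u(2)]
        unit_class_mult[of u "foldr (\<otimes>) fs \<one>"] multlist_closed[of fs]
      by (simp add: facts_def)
    then show ?case by simp
  qed
  from this[of fs] fs show ?thesis by (auto simp: factors_def atoms_def)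
qed

text \<open>Writing \<open>a = u \<otimes> b\<close>, add the class of \<open>u\<close> to any
  factorization of \<open>b\<close>. This ensures that the distances in the formulas are genuine
  minima.\<close>

lemma facts_inter_ideal_nonempty:
  assumes u: "u \<in> atoms G" and a: "a \<in> u <# carrier G"
  shows "facts G a \<inter> fact_ideal G {#unit_class G u#} \<noteq> {}"
proof -
  have uc: "u \<in> carrier G" "unit_class G u \<in> atoms (reduced G)"
    using u by (simp_all add: atoms_reduced) (simp add: atoms_def)
  from a obtain b where b: "b \<in> carrier G" "a = u \<otimes> b" by (auto simp: l_coset_def)
  then obtain z where z: "z \<in> facts G b" using facts_nonempty by blast
  have c: "{#unit_class G u#} \<in> carrier (fact_monoid G)" "z \<in> carrier (fact_monoid G)"
    using uc z by (auto simp: fact_monoid_def facts_def)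
  moreover from this have "{#unit_class G u#} + z \<in> carrier (fact_monoid G)"
    by (simp add: fact_monoid_def)
  ultimately have "{#unit_class G u#} + z \<in> facts G a \<inter> fact_ideal G {#unit_class G u#}"
    using uc b z fact_hom_add[OF c] fact_hom_single[OF uc(2)] unit_class_mult[of u b]
    by (simp add: facts_def fact_ideal_single)
  then show ?thesis by blast
qed

text \<open>For \<le>, every distance is dominated by one at an element carrying an atom of the
  relation monoid. For the converse, each listed distance is bounded by the corresponding
  \<open>tame\<close> value.\<close>

lemma tame_sup_atom:
  assumes u: "u \<in> atoms G"
  shows "tame_sup G (carrier G) {{#unit_class G u#}} =
    Sup {enat (fact_dist_set x (facts G a \<inter> fact_ideal G {#unit_class G u#})) | a x.
           a \<in> u <# carrier G \<and> x \<in> facts G a \<and> rel_atoms_at G a \<noteq> {}}"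
    (is "_ = Sup ?S")
proof (rule antisym)
  show "tame_sup G (carrier G) {{#unit_class G u#}} \<le> Sup ?S"
    unfolding tame_sup_def
  proof (rule Sup_least, clarify)
    fix a assume a: "a \<in> carrier G"
    have "enat (fact_dist_set z (facts G a \<inter> fact_ideal G {#unit_class G u#})) \<le> Sup ?S"
      if ne: "facts G a \<inter> fact_ideal G {#unit_class G u#} \<noteq> {}" and z: "z \<in> facts G a" for z
    proof -
      obtain a' x where "a' \<in> u <# carrier G" "x \<in> facts G a'" "rel_atoms_at G a' \<noteq> {}"
        and le: "fact_dist_set z (facts G a \<inter> fact_ideal G {#unit_class G u#}) \<le>
          fact_dist_set x (facts G a' \<inter> fact_ideal G {#unit_class G u#})"
        using fact_dist_set_le_rel_atom[OF u a z ne] .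
      then have "enat (fact_dist_set x (facts G a' \<inter> fact_ideal G {#unit_class G u#})) \<in> ?S"
        by blast
      then show ?thesis using le by (meson Sup_upper2 enat_ord_simps(1))
    qed
    \<comment> \<open>If no factorization of \<open>a\<close> contains \<open>u\<close>, then
      \<open>tame\<close> is 0; otherwise the bound just proved applies to every
      \<open>z\<close>.\<close>
    then show "tame G a {#unit_class G u#} \<le> Sup ?S"
      by (auto simp: tame_eq_Sup intro: SUP_least)
  qed
next
  show "Sup ?S \<le> tame_sup G (carrier G) {{#unit_class G u#}}"
  proof (rule Sup_least, clarify)
    fix a x assume a: "a \<in> u <# carrier G" and x: "x \<in> facts G a"
    have "enat (fact_dist_set x (facts G a \<inter> fact_ideal G {#unit_class G u#}))
        \<le> tame G a {#unit_class G u#}"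
      using facts_inter_ideal_nonempty[OF u a] x
      by (simp only: tame_eq_Sup if_False) (rule SUP_upper)
    also have "\<dots> \<le> tame_sup G (carrier G) {{#unit_class G u#}}"
      unfolding tame_sup_def using a u
      by (intro Sup_upper) (auto simp: l_coset_def atoms_def)
    finally show "enat (fact_dist_set x (facts G a \<inter> fact_ideal G {#unit_class G u#}))
        \<le> tame_sup G (carrier G) {{#unit_class G u#}}" .
  qed
qed

lemma Sup_UNION: "Sup (\<Union>i\<in>I. A i) = (SUP i\<in>I. Sup (A i))"
  for A :: "'i \<Rightarrow> 'c :: complete_lattice set"
  using SUP_UNION[of "\<lambda>x. x" A I] by simp

text \<open>By \<open>atoms_reduced\<close>, the atoms of the reduced monoid are indexed by those of
  \<open>G\<close>, so the defining set splits into a union over \<open>u\<close>.\<close>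

lemma tame_degree_eq_SUP:
  "tame_degree G = (SUP u\<in>atoms G. tame_sup G (carrier G) {{#unit_class G u#}})"
proof -
  have "{tame G a x | a x. a \<in> carrier G \<and> x \<in> (\<lambda>p. {#p#}) ` atoms (reduced G)} =
      (\<Union>u\<in>atoms G. {tame G a x | a x. a \<in> carrier G \<and> x \<in> {{#unit_class G u#}}})"
    unfolding atoms_reduced by blast
  then show ?thesis by (simp add: tame_degree_def tame_sup_def Sup_UNION del: UN_simps)
qed

end

theorem theorem4p10:
  fixes H :: "('a, 'b) monoid_scheme"
  assumes "atomic_monoid H"
  shows "(\<forall>u \<in> atoms H.
            tame_sup H (carrier H) {{#unit_class H u#}} =
              Sup {enat (fact_dist_set x (facts H a \<inter> fact_ideal H {#unit_class H u#})) | a x.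
                     a \<in> u <#\<^bsub>H\<^esub> carrier H \<and> x \<in> facts H a \<and> rel_atoms_at H a \<noteq> {}}) \<and>
         tame_degree H =
           Sup {enat (fact_dist_set x (facts H a \<inter> fact_ideal H {#unit_class H u#})) | u a x.
                  a \<in> u <#\<^bsub>H\<^esub> carrier H \<and> x \<in> facts H a \<and> rel_atoms_at H a \<noteq> {} \<and> u \<in> atoms H}"
proof -
  interpret atomic_monoid H by fact
  let ?S = "\<lambda>u. {enat (fact_dist_set x (facts H a \<inter> fact_ideal H {#unit_class H u#})) | a x.
    a \<in> u <#\<^bsub>H\<^esub> carrier H \<and> x \<in> facts H a \<and> rel_atoms_at H a \<noteq> {}}"
  have "tame_degree H = (SUP u\<in>atoms H. Sup (?S u))"
    unfolding tame_degree_eq_SUP by (rule SUP_cong) (simp_all only: tame_sup_atom)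
  also have "\<dots> = Sup (\<Union>u\<in>atoms H. ?S u)"
    by (rule Sup_UNION[symmetric])
  also have "(\<Union>u\<in>atoms H. ?S u) =
      {enat (fact_dist_set x (facts H a \<inter> fact_ideal H {#unit_class H u#})) | u a x.
         a \<in> u <#\<^bsub>H\<^esub> carrier H \<and> x \<in> facts H a \<and> rel_atoms_at H a \<noteq> {} \<and> u \<in> atoms H}"
    by blast
  finally show ?thesis using tame_sup_atom by blast
qed

end
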